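(* Let $n\in\mathbf{N}$, $n\ge3$, and let $X\in\Theta_n$. Then $$c_X\ge\frac{6}{n^2-n}.$$ Moreover, if $\lambda_0$ is the smallest eigenvalue of $X$, then $$c_X\ge\min\left(\frac{6}{(n^2-n)(1-\lambda_0)},\,1\right),$$ where the right-hand side is interpreted as $1$ if $\lambda_0=1$.
   Context: A correlation matrix is a complex, positive semidefinite matrix having all diagonal entries equal to $1$; $\Theta_n$ denotes the set of all $n\times n$ correlation matrices. $\mathcal{C}_n$ is the convex hull of $\{Y\in\Theta_n\mid \mathrm{rank}(Y)=1\}$. For $X\in\Theta_n$, with $I$ the $n\times n$ identity matrix, $$c_X=\sup\{t\in[0,1]\mid tX+(1-t)I\in\mathcal{C}_n\}.$$ *)

theory Defs
  imports "HOL-Analysis.Analysis"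
begin

definition hermitian :: "complex^'n^'n \<Rightarrow> bool" where
  "hermitian A \<longleftrightarrow> (\<forall>i j. A $ i $ j = cnj (A $ j $ i))"

(* The form x* A x is real for hermitian A, so taking Re loses nothing. *)
definition pos_semidef :: "complex^'n^'n \<Rightarrow> bool" where
  "pos_semidef A \<longleftrightarrow> hermitian A \<and>
     (\<forall>x :: complex^'n. 0 \<le> Re (\<Sum>i\<in>UNIV. \<Sum>j\<in>UNIV. cnj (x $ i) * A $ i $ j * x $ j))"

definition correlation_matrices :: "(complex^'n^'n) set" where
  "correlation_matrices = {A. pos_semidef A \<and> (\<forall>i. A $ i $ i = 1)}"

definition rank_one_hull :: "(complex^'n^'n) set" where
  "rank_one_hull = convex hull {Y \<in> correlation_matrices. rank Y = 1}"

definition corr_coeff :: "complex^'n^'n \<Rightarrow> real" where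
  "corr_coeff X = Sup {t \<in> {0..1}. t *\<^sub>R X + (1 - t) *\<^sub>R mat 1 \<in> rank_one_hull}"

definition matrix_eigenvalue :: "complex^'n^'n \<Rightarrow> complex \<Rightarrow> bool" where
  "matrix_eigenvalue A \<mu> \<longleftrightarrow> (\<exists>v. v \<noteq> 0 \<and> A *v v = \<mu> *s v)"

(* Intended for hermitian A, where all eigenvalues are real; hence only real mu are compared. *)
definition smallest_eigenvalue :: "complex^'n^'n \<Rightarrow> real \<Rightarrow> bool" where
  "smallest_eigenvalue A l \<longleftrightarrow> matrix_eigenvalue A (complex_of_real l) \<and>
     (\<forall>\<mu> :: real. matrix_eigenvalue A (complex_of_real \<mu>) \<longrightarrow> l \<le> \<mu>)"

end

theory Submission
  imports Defs
begin

text \<open>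
  Averaging over random signs of the phases outside a set \<open>T\<close> of indices shows that deleting the
  off-diagonal entries outside \<open>T \<times> T\<close> preserves the hull of the rank one correlation matrices.
  If \<open>T\<close> has three elements, every correlation matrix supported on \<open>T \<times> T\<close> and the diagonal lies in
  this hull: by Krein--Milman it suffices to consider an extreme point \<open>A\<close>, and if two of its columns
  \<open>a\<close>, \<open>b\<close> with indices in \<open>T\<close> were independent, then the four-dimensional real space of hermitian
  combinations of \<open>a a*\<close>, \<open>b b*\<close>, \<open>a b*\<close>, \<open>b a*\<close> would contain a nonzero matrix with zero diagonal,
  in whose direction \<open>A\<close> could be perturbed both ways.  Each off-diagonal position lies in \<open>n - 2\<close> of
  the \<open>n (n - 1) (n - 2) / 6\<close> triples, so averaging the truncations of \<open>X\<close> over all triples yields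
  \<open>t X + (1 - t) I\<close> with \<open>t = 6 / (n^2 - n)\<close>.  The second bound comes from applying the first one
  to \<open>(X - \<lambda>\<^sub>0 I) / (1 - \<lambda>\<^sub>0)\<close>.
\<close>

section \<open>Quadratic forms\<close>

definition quad :: "complex^'n^'n \<Rightarrow> complex^'n \<Rightarrow> real" where
  "quad A x = Re (\<Sum>i\<in>UNIV. \<Sum>j\<in>UNIV. cnj (x $ i) * A $ i $ j * x $ j)"

lemma pos_semidef_iff: "pos_semidef A \<longleftrightarrow> hermitian A \<and> (\<forall>x. 0 \<le> quad A x)"
  by (simp add: pos_semidef_def quad_def)

lemma correlation_matrices_iff:
  "A \<in> correlation_matrices \<longleftrightarrow> hermitian A \<and> (\<forall>x. 0 \<le> quad A x) \<and> (\<forall>i. A $ i $ i = 1)"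
  by (simp add: correlation_matrices_def pos_semidef_iff conj_assoc)

lemma hermitianD: "hermitian A \<Longrightarrow> cnj (A $ i $ j) = A $ j $ i"
  by (metis hermitian_def)

lemma quad_mult: "quad A x = Re (\<Sum>i\<in>UNIV. cnj (x $ i) * (A *v x) $ i)"
  by (simp add: quad_def matrix_vector_mult_def sum_distrib_left mult.assoc)

lemma quad_add: "quad (A + B) x = quad A x + quad B x"
  by (simp add: quad_def ring_distribs sum.distrib)

lemma quad_scaleR: "quad (c *\<^sub>R A) x = c * quad A x"
proof -
  have "(\<Sum>i\<in>UNIV. \<Sum>j\<in>UNIV. cnj (x $ i) * (c *\<^sub>R A) $ i $ j * x $ j) =
        of_real c * (\<Sum>i\<in>UNIV. \<Sum>j\<in>UNIV. cnj (x $ i) * A $ i $ j * x $ j)"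
    unfolding sum_distrib_left
    by (intro sum.cong refl) (simp add: scaleR_conv_of_real[where 'a = complex] mult_ac)
  then show ?thesis
    by (simp add: quad_def)
qed

lemma quad_mat_1: "quad (mat 1) x = (norm x)\<^sup>2"
proof -
  have "(\<Sum>j\<in>UNIV. cnj (x $ i) * mat 1 $ i $ j * x $ j) = of_real ((cmod (x $ i))\<^sup>2)" for i
  proof -
    have "(\<Sum>j\<in>UNIV. cnj (x $ i) * mat 1 $ i $ j * x $ j) =
          (\<Sum>j\<in>UNIV. if i = j then cnj (x $ i) * x $ j else 0)"
      by (intro sum.cong refl) (simp add: mat_def)
    also have "\<dots> = x $ i * cnj (x $ i)"
      by (simp add: mult.commute)
    finally show ?thesis
      by (simp add: complex_norm_square[symmetric])
  qed
  then show ?thesis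
    by (simp add: quad_def norm_vec_def L2_set_def sum_nonneg)
qed

lemma quad_scale_vector: "quad A (of_real c *s x) = c\<^sup>2 * quad A x"
proof -
  have "(\<Sum>i\<in>UNIV. \<Sum>j\<in>UNIV. cnj ((of_real c *s x) $ i) * A $ i $ j * (of_real c *s x) $ j) =
        of_real (c\<^sup>2) * (\<Sum>i\<in>UNIV. \<Sum>j\<in>UNIV. cnj (x $ i) * A $ i $ j * x $ j)"
    unfolding sum_distrib_left
    by (intro sum.cong refl) (simp add: mult_ac power2_eq_square)
  then show ?thesis
    by (simp add: quad_def)
qed

lemma mult_axis_nth: "(A *v axis j c) $ k = A $ k $ j * (c :: 'a :: semiring_1)"
  by (simp add: matrix_vector_mult_def axis_def if_distrib cong: if_cong)

text \<open>Second-order expansion along one coordinate. Hermitian symmetry makes the two cross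
  terms conjugate, so that they combine into twice a real part.\<close>

lemma quad_add_axis:
  assumes "hermitian A"
  shows "quad A (x + axis i c) =
    quad A x + 2 * Re (cnj c * (A *v x) $ i) + (cmod c)\<^sup>2 * Re (A $ i $ i)"
proof -
  have ax: "axis i c $ k = (if k = i then c else 0)" for k
    by (simp add: axis_def)
  have cross: "(\<Sum>k\<in>UNIV. cnj (x $ k) * (A $ k $ i * c)) = c * cnj ((A *v x) $ i)"
    using assms by (simp add: matrix_vector_mult_def sum_distrib_left hermitianD mult_ac)
  have single: "(\<Sum>k\<in>UNIV. cnj (axis i c $ k) * g k) = cnj c * g i" for g
    by (simp add: ax if_distrib if_distribR cong: if_cong)
  have "(\<Sum>k\<in>UNIV. cnj ((x + axis i c) $ k) * (A *v (x + axis i c)) $ k) =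
     (\<Sum>k\<in>UNIV. cnj (x $ k) * (A *v x) $ k) + c * cnj ((A *v x) $ i)
     + cnj c * (A *v x) $ i + cnj c * (A $ i $ i * c)"
    by (simp add: matrix_vector_right_distrib mult_axis_nth ring_distribs sum.distrib cross single)
  moreover have "Re (cnj c * (A $ i $ i * c)) = (cmod c)\<^sup>2 * Re (A $ i $ i)"
  proof -
    have "cnj c * (A $ i $ i * c) = of_real ((cmod c)\<^sup>2) * A $ i $ i"
      by (simp only: complex_norm_square) (simp add: mult_ac)
    then show ?thesis
      by (simp only: Re_complex_of_real Im_complex_of_real times_complex.sel)
  qed
  moreover have "Re (c * cnj ((A *v x) $ i)) = Re (cnj c * (A *v x) $ i)"
    by simp
  ultimately show ?thesis
    by (simp only: quad_mult plus_complex.sel)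
qed

lemma quad_axis_1: "quad A (axis i 1) = Re (A $ i $ i)"
proof -
  have "(\<Sum>k\<in>UNIV. cnj (axis i 1 $ k) * A $ k $ i) = (\<Sum>k\<in>UNIV. if k = i then A $ i $ i else 0)"
    by (intro sum.cong refl) (simp add: axis_def)
  then show ?thesis
    by (simp add: quad_mult mult_axis_nth)
qed

text \<open>Cauchy-Schwarz for the semidefinite form of \<open>A\<close>, applied to
  \<open>x\<close> and the \<open>i\<close>-th basis vector. In particular
  \<open>quad A x = 0\<close> forces \<open>A *v x = 0\<close>.\<close>

lemma norm_mult_nth_le:
  assumes "pos_semidef A"
  shows "(cmod ((A *v x) $ i))\<^sup>2 \<le> Re (A $ i $ i) * quad A x"
proof -
  define a where "a = (A *v x) $ i"
  define d where "d = Re (A $ i $ i)"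
  have h: "hermitian A" and p: "\<And>y. 0 \<le> quad A y"
    using assms by (auto simp: pos_semidef_iff)
  have d0: "0 \<le> d"
    using p[of "axis i 1"] by (simp add: quad_axis_1 d_def)
  \<comment> \<open>Move \<open>x\<close> along the \<open>i\<close>-th axis against the phase of
    \<open>a\<close>; this leaves a real quadratic in \<open>t\<close>.\<close>
  have ineq: "0 \<le> quad A x - 2 * t * (cmod a)\<^sup>2 + t\<^sup>2 * (cmod a)\<^sup>2 * d" for t
  proof -
    have "Re (cnj (- of_real t * a) * a) = - t * (cmod a)\<^sup>2"
      by (simp add: cmod_power2) (simp add: power2_eq_square algebra_simps)
    moreover have "(cmod (- of_real t * a))\<^sup>2 = t\<^sup>2 * (cmod a)\<^sup>2"
      by (simp add: norm_mult power_mult_distrib)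
    ultimately show ?thesis
      using p[of "x + axis i (- of_real t * a)"]
      unfolding quad_add_axis[OF h] a_def[symmetric] d_def[symmetric] by simp
  qed
  have "(cmod a)\<^sup>2 \<le> d * quad A x"
  proof (cases "d = 0")
    case True
    have "(cmod a)\<^sup>2 = 0"
    proof (rule ccontr)
      assume "(cmod a)\<^sup>2 \<noteq> 0"
      then show False
        \<comment> \<open>For \<open>d = 0\<close> the bound is affine in \<open>t\<close>, and this
          \<open>t\<close> gives it the value -1.\<close>
        using ineq[of "(quad A x + 1) / (2 * (cmod a)\<^sup>2)"] True by (simp add: field_simps)
    qed
    with True show ?thesis by simp
  next
    case False
    then have "d > 0" using d0 by simp
    then show ?thesis
      \<comment> \<open>\<open>1 / d\<close> minimises the quadratic.\<close>
      using ineq[of "1 / d"] by (simp add: field_simps power2_eq_square)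
  qed
  then show ?thesis
    by (simp add: a_def d_def)
qed

lemma norm_entry_le:
  assumes "pos_semidef A"
  shows "(cmod (A $ i $ j))\<^sup>2 \<le> Re (A $ i $ i) * Re (A $ j $ j)"
  using norm_mult_nth_le[OF assms, of "axis j 1" i] by (simp add: quad_axis_1 mult_axis_nth)

lemma correlation_entry_le:
  assumes "A \<in> correlation_matrices"
  shows "cmod (A $ i $ j) \<le> 1"
proof -
  have "(cmod (A $ i $ j))\<^sup>2 \<le> 1"
    using norm_entry_le[of A i j] assms by (simp add: correlation_matrices_def)
  then show ?thesis
    by (simp add: abs_square_le_1)
qed

section \<open>Convexity and compactness of the set of correlation matrices\<close>

lemma hermitian_add_scaleR:
  "hermitian A \<Longrightarrow> hermitian B \<Longrightarrow> hermitian (a *\<^sub>R A + b *\<^sub>R B)"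
  unfolding hermitian_def[of "_ + _"] by (simp add: hermitianD)

lemma hermitian_mat_1: "hermitian (mat 1)"
  by (simp add: hermitian_def mat_def)

lemma convex_correlation_matrices: "convex (correlation_matrices :: (complex^'n^'n) set)"
proof (rule convexI)
  fix A B :: "complex^'n^'n" and u v :: real
  assume "A \<in> correlation_matrices" "B \<in> correlation_matrices" "0 \<le> u" "0 \<le> v" "u + v = 1"
  then show "u *\<^sub>R A + v *\<^sub>R B \<in> correlation_matrices"
    by (simp add: correlation_matrices_iff hermitian_add_scaleR quad_add quad_scaleR
        scaleR_left_distrib[symmetric])
qed

lemma compact_correlation_matrices: "compact (correlation_matrices :: (complex^'n^'n) set)"
proof -
  have "norm A \<le> (\<Sum>i\<in>(UNIV::'n set). \<Sum>j\<in>(UNIV::'n set). 1)"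
    if "A \<in> correlation_matrices" for A :: "complex^'n^'n"
  proof -
    have "norm A \<le> (\<Sum>i\<in>UNIV. norm (A $ i))"
      unfolding norm_vec_def by (rule L2_set_le_sum) simp
    also have "\<dots> \<le> (\<Sum>i\<in>UNIV. \<Sum>j\<in>UNIV. cmod (A $ i $ j))"
      unfolding norm_vec_def[of "A $ _"] by (intro sum_mono L2_set_le_sum) simp
    also have "\<dots> \<le> (\<Sum>i\<in>(UNIV::'n set). \<Sum>j\<in>(UNIV::'n set). 1)"
      by (intro sum_mono correlation_entry_le that)
    finally show ?thesis .
  qed
  then have "bounded (correlation_matrices :: (complex^'n^'n) set)"
    unfolding bounded_iff by blast
  moreover have "closed (correlation_matrices :: (complex^'n^'n) set)"
    unfolding correlation_matrices_def pos_semidef_def hermitian_def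
    by (intro closed_Collect_conj closed_Collect_all closed_Collect_eq closed_Collect_le
        continuous_intros)
  ultimately show ?thesis
    by (simp add: compact_eq_bounded_closed)
qed

section \<open>Unimodular rank one matrices\<close>

definition outer :: "complex^'n \<Rightarrow> complex^'n^'n" where
  "outer v = (\<chi> i j. v $ i * cnj (v $ j))"

text \<open>With explicit generators, sign changes can be checked on vectors. Lower bounds for
  \<open>corr_coeff\<close> then come from the inclusion in \<open>rank_one_hull\<close>.\<close>

definition unimodular_hull :: "(complex^'n^'n) set" where
  "unimodular_hull = convex hull {outer v |v. \<forall>i. cmod (v $ i) = 1}"

lemma quad_outer: "quad (outer v) x = (cmod (\<Sum>i\<in>UNIV. cnj (v $ i) * x $ i))\<^sup>2"
proof -
  let ?s = "\<Sum>i\<in>UNIV. cnj (v $ i) * x $ i"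
  have "(\<Sum>i\<in>UNIV. \<Sum>j\<in>UNIV. cnj (x $ i) * outer v $ i $ j * x $ j) = cnj ?s * ?s"
    by (simp add: outer_def sum_product mult_ac)
  also have "\<dots> = of_real ((cmod ?s)\<^sup>2)"
    by (simp only: complex_norm_square mult.commute)
  finally show ?thesis
    by (simp add: quad_def)
qed

lemma outer_correlation:
  assumes "\<forall>i. cmod (v $ i) = 1"
  shows "outer v \<in> correlation_matrices"
proof -
  have "v $ i * cnj (v $ i) = 1" for i
    using assms by (simp add: complex_norm_square[symmetric])
  then show ?thesis
    by (simp add: correlation_matrices_iff quad_outer hermitian_def)
       (simp add: outer_def)
qed

text \<open>Every row is a nonzero multiple of the conjugate of \<open>v\<close>, so the row space
  is a line.\<close>

lemma rank_outer:
  fixes v :: "complex^'n"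
  assumes "\<forall>i. cmod (v $ i) = 1"
  shows "rank (outer v) = 1"
proof -
  let ?w = "(\<chi> j. cnj (v $ j)) :: complex^'n"
  have row: "row i (outer v) = v $ i *s ?w" for i
    by (simp add: vec_eq_iff row_def outer_def)
  have nz: "v $ i \<noteq> 0" for i
    using assms by (metis norm_zero zero_neq_one)
  then have w: "?w \<noteq> 0"
    by (auto simp: vec_eq_iff)
  have "vec.span (rows (outer v)) = vec.span {?w}"
  proof (rule vec.span_eq[THEN iffD2], safe)
    fix x assume "x \<in> rows (outer v)"
    then show "x \<in> vec.span {?w}"
      by (auto simp: rows_def row intro: vec.span_scale vec.span_base)
  next
    fix i :: 'n
    have "inverse (v $ i) *s row i (outer v) \<in> vec.span (rows (outer v))"
      by (intro vec.span_scale vec.span_base) (auto simp: rows_def)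
    then show "?w \<in> vec.span (rows (outer v))"
      by (simp add: row nz vec_eq_iff)
  qed
  then have "vec.dim (rows (outer v)) = vec.dim {?w}"
    by (metis vec.dim_span)
  then show ?thesis
    using w by (simp add: row_rank_def_gen)
qed

lemma unimodular_hull_subset: "(unimodular_hull :: (complex^'n^'n) set) \<subseteq> rank_one_hull"
  unfolding unimodular_hull_def rank_one_hull_def
proof (rule hull_mono, rule subsetI)
  fix A :: "complex^'n^'n" assume "A \<in> {outer v |v. \<forall>i. cmod (v $ i) = 1}"
  then obtain v where v: "A = outer v" "\<forall>i. cmod (v $ i) = 1"
    by blast
  then show "A \<in> {Y \<in> correlation_matrices. rank Y = 1}"
    using outer_correlation[OF v(2)] rank_outer[OF v(2)] by simp
qed

lemma outer_unimodular_hull: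
  assumes "\<forall>i. cmod (v $ i) = 1"
  shows "outer v \<in> unimodular_hull"
proof -
  have "outer v \<in> {outer v |v. \<forall>i. cmod (v $ i) = 1}"
    using assms by blast
  then show ?thesis
    unfolding unimodular_hull_def by (rule hull_inc)
qed

lemma convex_unimodular_hull: "convex unimodular_hull"
  by (simp add: unimodular_hull_def)

section \<open>Truncation\<close>

text \<open>Conjugation by the diagonal matrix with -1 at \<open>k\<close> and 1 elsewhere.\<close>

definition flip :: "'n \<Rightarrow> complex^'n^'n \<Rightarrow> complex^'n^'n" where
  "flip k A = (\<chi> i j. (if i = k then - 1 else 1) * A $ i $ j * (if j = k then - 1 else 1))"

definition truncate :: "'n set \<Rightarrow> complex^'n^'n \<Rightarrow> complex^'n^'n" where
  "truncate T A = (\<chi> i j. if i = j \<or> i \<in> T \<and> j \<in> T then A $ i $ j else 0)"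

lemma truncate_nth:
  "truncate T A $ i $ j = (if i = j \<or> i \<in> T \<and> j \<in> T then A $ i $ j else 0)"
  by (simp add: truncate_def)

text \<open>\<open>flip k\<close> is linear and permits only a sign change in coordinate
  \<open>k\<close> of the vector behind a generator.\<close>

lemma flip_unimodular_hull:
  assumes "A \<in> unimodular_hull"
  shows "flip k A \<in> unimodular_hull"
proof -
  have "linear (flip k)"
    by (rule linearI) (auto simp: flip_def vec_eq_iff)
  then have "flip k ` unimodular_hull =
      convex hull (flip k ` {outer v |v. \<forall>i. cmod (v $ i) = 1})"
    unfolding unimodular_hull_def by (rule convex_hull_linear_image)
  moreover have "flip k ` {outer v |v. \<forall>i. cmod (v $ i) = 1} \<subseteq>
      {outer v |v. \<forall>i. cmod (v $ i) = 1}"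
  proof safe
    fix v :: "complex^'a" assume v: "\<forall>i. cmod (v $ i) = 1"
    let ?w = "(\<chi> i. (if i = k then - 1 else 1) * v $ i) :: complex^'a"
    have "flip k (outer v) = outer ?w"
      by (auto simp: vec_eq_iff flip_def outer_def)
    moreover have "\<forall>i. cmod (?w $ i) = 1"
      using v by simp
    ultimately show "\<exists>w. flip k (outer v) = outer w \<and> (\<forall>i. cmod (w $ i) = 1)"
      by blast
  qed
  ultimately have "flip k ` unimodular_hull \<subseteq> unimodular_hull"
    by (simp only: unimodular_hull_def hull_mono)
  with assms show ?thesis
    by blast
qed

lemma flip_correlation:
  assumes "A \<in> correlation_matrices"
  shows "flip k A \<in> correlation_matrices"
proof -
  have "quad (flip k A) x = quad A (\<chi> i. (if i = k then - 1 else 1) * x $ i)" for x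
    unfolding quad_def flip_def by (intro arg_cong[where f = Re] sum.cong refl) auto
  moreover have "hermitian (flip k A)"
    unfolding hermitian_def using hermitianD[of A] assms
    by (simp add: correlation_matrices_iff flip_def)
  ultimately show ?thesis
    using assms by (simp add: correlation_matrices_iff) (simp add: flip_def)
qed

text \<open>Indices outside \<open>T\<close> are removed one at a time by averaging with
  \<open>flip k\<close>. The set \<open>S\<close> is kept abstract to cover both the hull and the
  correlation matrices.\<close>

lemma truncate_closed:
  assumes S: "convex S" "\<And>k A. A \<in> S \<Longrightarrow> flip k A \<in> S" and A: "A \<in> S"
  shows "truncate T A \<in> S"
proof -
  have "truncate (- K) A \<in> S" if "finite K" for K
    using that
  proof (induction K)
    case empty
    have "truncate (- {}) A = A"
      by (simp add: vec_eq_iff truncate_nth)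
    then show ?case using A by simp
  next
    case (insert k K)
    let ?B = "truncate (- K) A"
    \<comment> \<open>The off-diagonal entries in row and column \<open>k\<close> cancel; the
      diagonal entry at \<open>k\<close> changes sign twice and survives.\<close>
    have "truncate (- insert k K) A = (1/2) *\<^sub>R ?B + (1/2) *\<^sub>R flip k ?B"
      by (auto simp: vec_eq_iff truncate_nth flip_def scaleR_conv_of_real[where 'a = complex])
    then show ?case
      using convexD[OF S(1) insert.IH S(2)[OF insert.IH, of k], of "1/2" "1/2"] by simp
  qed
  from this[of "- T"] show ?thesis by simp
qed

lemma truncate_unimodular_hull: "A \<in> unimodular_hull \<Longrightarrow> truncate T A \<in> unimodular_hull"
  by (rule truncate_closed[OF convex_unimodular_hull flip_unimodular_hull])

lemma truncate_correlation:
  "A \<in> correlation_matrices \<Longrightarrow> truncate T A \<in> correlation_matrices"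
  by (rule truncate_closed[OF convex_correlation_matrices flip_correlation])

text \<open>The identity is the truncation of the all-ones matrix to the empty index set.\<close>

lemma mat_1_unimodular_hull: "(mat 1 :: complex^'n^'n) \<in> unimodular_hull"
proof -
  let ?v = "(\<chi> i. 1) :: complex^'n"
  have "truncate {} (outer ?v) \<in> unimodular_hull"
    by (intro truncate_unimodular_hull outer_unimodular_hull) simp
  moreover have "truncate {} (outer ?v) = mat 1"
    by (simp add: vec_eq_iff truncate_nth outer_def mat_def)
  ultimately show ?thesis
    by simp
qed

section \<open>Triples\<close>

text \<open>The vector \<open>?x\<close> has form value 1 - 2 + 1 = 0, hence lies in the kernel of
  \<open>A\<close>: column \<open>l\<close> is \<open>A $ i $ l\<close> times column
  \<open>i\<close>.\<close>

lemma correlation_unimodular_entry: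
  assumes A: "A \<in> correlation_matrices" and u: "cmod (A $ i $ l) = 1"
  shows "A $ m $ l = A $ m $ i * A $ i $ l"
proof (cases "i = l")
  case False
  let ?x = "axis l 1 + axis i (- A $ i $ l) :: complex^'a"
  have h: "hermitian A" and d: "\<And>r. A $ r $ r = 1" and p: "pos_semidef A"
    using A by (auto simp: correlation_matrices_iff pos_semidef_iff)
  have "cnj (- A $ i $ l) * A $ i $ l = - (A $ i $ l * cnj (A $ i $ l))"
    by simp
  also have "\<dots> = - 1"
    by (simp only: complex_norm_square[symmetric] u) simp
  finally have "Re (cnj (- A $ i $ l) * A $ i $ l) = - 1"
    by simp
  then have "quad A ?x = 0"
    unfolding quad_add_axis[OF h] mult_axis_nth quad_axis_1 mult_1_right d norm_minus_cancel u
    by simp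
  then have "(A *v ?x) $ m = 0"
    using norm_mult_nth_le[OF p, of ?x m] by simp
  then show ?thesis
    by (simp add: matrix_vector_right_distrib mult_axis_nth)
qed (use A in \<open>simp add: correlation_matrices_iff\<close>)

text \<open>Otherwise a nonzero hermitian \<open>H\<close> with zero diagonal is built from columns
  \<open>i\<close> and \<open>j\<close>. Its form is dominated by that of \<open>A\<close>, so
  \<open>A\<close> is the midpoint of two other members of the set.\<close>

lemma extreme_triple_unimodular:
  assumes ext: "A extreme_point_of {A \<in> correlation_matrices. truncate {i, j, k} A = A}"
  shows "cmod (A $ i $ j) = 1"
proof (rule ccontr)
  assume u: "cmod (A $ i $ j) \<noteq> 1"
  let ?K = "{A \<in> correlation_matrices. truncate {i, j, k} A = A}"
  have A: "A \<in> correlation_matrices" and tr: "truncate {i, j, k} A = A"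
    using ext by (auto simp: extreme_point_of_def)
  have h: "hermitian A" and d: "\<And>r. A $ r $ r = 1" and psd: "pos_semidef A"
    using A by (auto simp: correlation_matrices_iff pos_semidef_iff)
  \<comment> \<open>Both columns vanish off the triple, so the diagonal of \<open>H\<close> has to
    be controlled at \<open>i\<close>, \<open>j\<close> and \<open>k\<close> only.\<close>
  have supp: "A $ m $ i = 0 \<and> A $ m $ j = 0" if "m \<notin> {i, j, k}" for m
    using that truncate_nth[of "{i, j, k}" A m i] truncate_nth[of "{i, j, k}" A m j]
    unfolding tr by (auto split: if_splits)
  define b where "b = A $ i $ j"
  define s where "s = (cmod b)\<^sup>2"
  define x where "x = A $ k $ i"
  define y where "y = A $ k $ j"
  define r where "r = (cmod x)\<^sup>2 + (cmod y)\<^sup>2"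
  \<comment> \<open>The choice of \<open>p\<close> makes the diagonal entries of the direction \<open>H\<close> at \<open>i\<close> and \<open>j\<close> vanish;
    the one at \<open>k\<close> then vanishes iff \<open>Re (c * w) = 0\<close>.\<close>
  define w where "w = of_real (1 + s) * (x * cnj y) - of_real r * cnj b"
  define c where "c = (if w = 0 then 1 else \<i> * cnj w)"
  define p where "p = - (2 * Re (c * cnj b)) / (1 + s)"
  have s0: "0 \<le> s"
    by (simp add: s_def)
  have s1: "s \<noteq> 1"
    using u norm_ge_zero[of "A $ i $ j"]
    by (auto simp: s_def b_def power2_eq_1_iff simp del: norm_ge_zero)
  \<comment> \<open>For nonzero \<open>w\<close> the product \<open>c * w\<close> is the imaginary
    unit times the squared modulus of \<open>w\<close>; for \<open>w = 0\<close> any nonzero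
    \<open>c\<close> serves.\<close>
  have c0: "c \<noteq> 0" and cw: "Re (c * w) = 0"
    by (auto simp: c_def)
  have p: "p * (1 + s) = - (2 * Re (c * cnj b))"
    using s0 by (simp add: p_def)
  have bji: "A $ j $ i = cnj b"
    by (simp add: b_def hermitianD[OF h])
  \<comment> \<open>Giving both squares the same coefficient \<open>p\<close> makes the diagonal
    conditions at \<open>i\<close> and \<open>j\<close> coincide. One real condition, at
    \<open>k\<close>, then remains for the complex number \<open>c\<close>.\<close>
  define H :: "complex^'a^'a" where
    "H = (\<chi> m l. of_real p * (A $ m $ i * cnj (A $ l $ i)) + of_real p * (A $ m $ j * cnj (A $ l $ j))
       + c * (A $ m $ i * cnj (A $ l $ j)) + cnj c * (A $ m $ j * cnj (A $ l $ i)))"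
  have H_nth: "H $ m $ l =
      of_real p * (A $ m $ i * cnj (A $ l $ i)) + of_real p * (A $ m $ j * cnj (A $ l $ j))
       + c * (A $ m $ i * cnj (A $ l $ j)) + cnj c * (A $ m $ j * cnj (A $ l $ i))" for m l
    by (simp add: H_def)
  have H_herm: "hermitian H"
    unfolding hermitian_def H_nth by (simp add: algebra_simps)
  have H_diag': "H $ m $ m = of_real (p * ((cmod (A $ m $ i))\<^sup>2 + (cmod (A $ m $ j))\<^sup>2)
      + 2 * Re (c * (A $ m $ i * cnj (A $ m $ j))))" for m
  proof -
    have "c * (A $ m $ i * cnj (A $ m $ j)) + cnj c * (A $ m $ j * cnj (A $ m $ i)) =
        of_real (2 * Re (c * (A $ m $ i * cnj (A $ m $ j))))"
      by (simp only: complex_add_cnj[symmetric]) (simp add: mult_ac)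
    then show ?thesis
      unfolding H_nth complex_norm_square[symmetric] add.assoc
      by (simp add: distrib_left)
  qed
  have H_diag: "H $ m $ m = 0" for m
  proof -
    consider "m = i" | "m = j" | "m = k" | "m \<notin> {i, j, k}"
      by blast
    then show ?thesis
    proof cases
      case 1
      have "p * (1 + (cmod b)\<^sup>2) + 2 * Re (c * (1 * cnj b)) = 0"
        using p by (simp add: s_def)
      with 1 show ?thesis
        by (simp only: H_diag' d b_def norm_one power_one of_real_0)
    next
      case 2
      have "p * ((cmod (cnj b))\<^sup>2 + 1) + 2 * Re (c * (cnj b * cnj 1)) = 0"
        using p by (simp add: s_def add.commute)
      with 2 show ?thesis
        by (simp only: H_diag' d bji norm_one power_one of_real_0)
    next
      case 3
      \<comment> \<open>This is \<open>cw\<close> written out; multiplying by \<open>1 + s\<close>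
        clears the denominator of \<open>p\<close>.\<close>
      have "(1 + s) * Re (c * (x * cnj y)) = r * Re (c * cnj b)"
      proof -
        have "c * w = of_real (1 + s) * (c * (x * cnj y)) - of_real r * (c * cnj b)"
          by (simp add: w_def algebra_simps)
        then have "Re (c * w) = (1 + s) * Re (c * (x * cnj y)) - r * Re (c * cnj b)"
          by (simp only: minus_complex.sel Re_complex_of_real Im_complex_of_real
              times_complex.sel[of "of_real _"])
        with cw show ?thesis by simp
      qed
      then have "(1 + s) * (p * r + 2 * Re (c * (x * cnj y))) = r * (p * (1 + s) + 2 * Re (c * cnj b))"
        by (simp only: distrib_left mult_ac)
      then have "p * r + 2 * Re (c * (x * cnj y)) = 0"
        unfolding p using s0 by simp
      with 3 show ?thesis
        by (simp only: H_diag' r_def x_def y_def of_real_0)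
    next
      case 4
      then show ?thesis
        using supp[of m] by (simp add: H_nth)
    qed
  qed
  have H_off: "H $ m $ l = 0" if "m \<notin> {i, j, k} \<or> l \<notin> {i, j, k}" for m l
    using supp[of m] supp[of l] that by (auto simp: H_nth)
  have "H \<noteq> 0"
  proof
    assume "H = 0"
    then have "H $ i $ j = 0"
      by simp
    then have e: "2 * of_real p * b + c + cnj c * (b * b) = 0"
      by (simp add: H_nth d bji flip: b_def) (simp add: algebra_simps)
    have sb: "of_real s = b * cnj b"
      by (simp only: s_def complex_norm_square)
    have pc: "of_real p * (1 + of_real s) = - (c * cnj b + cnj c * b)"
    proof -
      have "of_real (p * (1 + s)) = - of_real (2 * Re (c * cnj b))"
        by (simp only: p of_real_minus)
      also have "\<dots> = - (c * cnj b + cnj (c * cnj b))"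
        by (simp only: complex_add_cnj)
      finally show ?thesis
        by simp
    qed
    \<comment> \<open>Eliminating \<open>p\<close> from \<open>H $ i $ j = 0\<close>. As
      \<open>s\<close> is not 1, this leaves \<open>c = cnj c * (b * b)\<close>, and taking moduli
      contradicts \<open>c0\<close> and \<open>s1\<close>.\<close>
    have "(1 - of_real s) * (c - cnj c * (b * b)) =
        (1 + of_real s) * (2 * of_real p * b + c + cnj c * (b * b))
        - 2 * b * (of_real p * (1 + of_real s) + (c * cnj b + cnj c * b))"
      unfolding sb by (simp add: algebra_simps)
    also have "\<dots> = 0"
      unfolding e pc by simp
    finally have "c = cnj c * (b * b)"
      using s1 by (simp add: of_real_eq_1_iff[symmetric, where 'a = complex] del: of_real_eq_1_iff)
    then have "cmod c = cmod c * s"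
      by (metis complex_mod_cnj norm_mult power2_eq_square s_def)
    then show False
      using c0 s1 by simp
  qed
  \<comment> \<open>Since \<open>H\<close> is a combination of products of columns \<open>i\<close>
    and \<open>j\<close>, its form sees \<open>z\<close> only through these two coordinates of
    \<open>A *v z\<close>.\<close>
  have quad_H: "quad H z = p * ((cmod ((A *v z) $ i))\<^sup>2 + (cmod ((A *v z) $ j))\<^sup>2)
      + 2 * Re (c * (cnj ((A *v z) $ i) * (A *v z) $ j))" for z
  proof -
    define f where "f q = (\<Sum>l\<in>UNIV. cnj (A $ l $ q) * z $ l)" for q
    have f: "f q = (A *v z) $ q" for q
      by (simp add: f_def matrix_vector_mult_def hermitianD[OF h])
    have cf: "cnj (f q) = (\<Sum>m\<in>UNIV. cnj (z $ m) * A $ m $ q)" for q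
      by (simp add: f_def mult.commute)
    have bil: "cnj (f q) * f q' =
        (\<Sum>m\<in>UNIV. \<Sum>l\<in>UNIV. cnj (z $ m) * A $ m $ q * (cnj (A $ l $ q') * z $ l))" for q q'
      by (simp only: cf) (simp only: f_def sum_product)
    have "(\<Sum>m\<in>UNIV. \<Sum>l\<in>UNIV. cnj (z $ m) * H $ m $ l * z $ l) =
        of_real p * (cnj (f i) * f i) + of_real p * (cnj (f j) * f j)
        + c * (cnj (f i) * f j) + cnj c * (cnj (f j) * f i)"
      unfolding bil sum_distrib_left sum.distrib[symmetric] H_nth
      by (intro sum.cong refl) (simp add: algebra_simps)
    also have "\<dots> = of_real (p * ((cmod (f i))\<^sup>2 + (cmod (f j))\<^sup>2))
        + (c * (cnj (f i) * f j) + cnj (c * (cnj (f i) * f j)))"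
      by (simp add: mult.commute[of "cnj (f i)" "f i"] mult.commute[of "cnj (f j)" "f j"]
          complex_norm_square[symmetric] distrib_left)
    finally show ?thesis
      by (simp only: quad_def f complex_add_cnj of_real_add[symmetric] Re_complex_of_real)
  qed
  \<comment> \<open>Cauchy-Schwarz bounds each squared coordinate by \<open>quad A z\<close>, so the
    form of \<open>H\<close> is at most \<open>2 * (\<bar>p\<bar> + cmod c)\<close> times that of
    \<open>A\<close>.\<close>
  define e where "e = 1 / (2 * (\<bar>p\<bar> + cmod c))"
  have e0: "0 < e"
    using c0 by (simp add: e_def add_nonneg_pos)
  have bound: "\<bar>e * quad H z\<bar> \<le> quad A z" for z
  proof -
    let ?\<alpha> = "(A *v z) $ i" and ?\<beta> = "(A *v z) $ j"
    have 1: "(cmod ?\<alpha>)\<^sup>2 + (cmod ?\<beta>)\<^sup>2 \<le> 2 * quad A z"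
      using norm_mult_nth_le[OF psd, of z i] norm_mult_nth_le[OF psd, of z j] by (simp add: d)
    have "\<bar>Re (c * (cnj ?\<alpha> * ?\<beta>))\<bar> \<le> cmod c * (cmod ?\<alpha> * cmod ?\<beta>)"
      using abs_Re_le_cmod[of "c * (cnj ?\<alpha> * ?\<beta>)"] by (simp add: norm_mult)
    moreover have "cmod c * (2 * (cmod ?\<alpha> * cmod ?\<beta>)) \<le> cmod c * ((cmod ?\<alpha>)\<^sup>2 + (cmod ?\<beta>)\<^sup>2)"
      using sum_squares_bound[of "cmod ?\<alpha>" "cmod ?\<beta>"]
      by (intro mult_left_mono) (simp_all add: mult.assoc)
    moreover have "\<bar>p * ((cmod ?\<alpha>)\<^sup>2 + (cmod ?\<beta>)\<^sup>2)\<bar> = \<bar>p\<bar> * ((cmod ?\<alpha>)\<^sup>2 + (cmod ?\<beta>)\<^sup>2)"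
      by (simp add: abs_mult)
    ultimately have "\<bar>quad H z\<bar> \<le> (\<bar>p\<bar> + cmod c) * ((cmod ?\<alpha>)\<^sup>2 + (cmod ?\<beta>)\<^sup>2)"
      unfolding quad_H distrib_right[of "\<bar>p\<bar>"] by linarith
    also have "\<dots> \<le> (\<bar>p\<bar> + cmod c) * (2 * quad A z)"
      using 1 by (intro mult_left_mono) simp_all
    finally have "e * \<bar>quad H z\<bar> \<le> e * ((\<bar>p\<bar> + cmod c) * (2 * quad A z))"
      using e0 by (intro mult_left_mono) simp_all
    also have "\<dots> = (2 * (\<bar>p\<bar> + cmod c) * e) * quad A z"
      by (simp only: mult_ac)
    also have "2 * (\<bar>p\<bar> + cmod c) * e = 1"
      using e0 by (auto simp: e_def)
    finally show ?thesis
      using e0 by (simp add: abs_mult)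
  qed
  have mem: "A + t *\<^sub>R H \<in> ?K" if "\<bar>t\<bar> = e" for t
  proof -
    have "0 \<le> quad (A + t *\<^sub>R H) z" for z
    proof -
      have "\<bar>t * quad H z\<bar> \<le> quad A z"
        using bound[of z] that e0 by (simp add: abs_mult)
      then show ?thesis
        by (simp add: quad_add quad_scaleR)
    qed
    moreover have "hermitian (A + t *\<^sub>R H)"
      using hermitian_add_scaleR[OF h H_herm, of 1 t] by simp
    moreover have "truncate {i, j, k} (A + t *\<^sub>R H) = A + t *\<^sub>R H"
    proof -
      have "A $ m $ l = 0" if "m \<noteq> l" "m \<notin> {i, j, k} \<or> l \<notin> {i, j, k}" for m l
        using that truncate_nth[of "{i, j, k}" A m l] unfolding tr by (auto split: if_splits)
      with H_off show ?thesis
        by (simp add: vec_eq_iff truncate_nth)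
    qed
    ultimately show ?thesis
      by (simp add: correlation_matrices_iff d H_diag)
  qed
  have "A \<in> open_segment (A + e *\<^sub>R H) (A + (- e) *\<^sub>R H)"
  proof -
    have "A + e *\<^sub>R H \<noteq> A + (- e) *\<^sub>R H"
    proof
      assume "A + e *\<^sub>R H = A + (- e) *\<^sub>R H"
      then have "e = - e \<or> H = 0"
        by (simp only: add_left_cancel scaleR_cancel_right)
      with e0 \<open>H \<noteq> 0\<close> show False by simp
    qed
    moreover have "midpoint (A + e *\<^sub>R H) (A + (- e) *\<^sub>R H) = A"
      by (simp add: midpoint_def scaleR_right_distrib scaleR_2[symmetric] flip: scaleR_half_double)
    ultimately show ?thesis
      by (metis midpoint_in_open_segment)
  qed
  then show False
    using ext mem[of e] mem[of "- e"] e0 by (simp add: extreme_point_of_def)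
qed

text \<open>Krein-Milman for the compact convex set of correlation matrices fixed by
  \<open>truncate T\<close>: each extreme point is a truncated unimodular rank one matrix.\<close>

lemma triple_unimodular_hull:
  assumes A: "A \<in> correlation_matrices" and tr: "truncate T A = A" and T: "card T = 3"
  shows "A \<in> unimodular_hull"
proof -
  let ?K = "{A \<in> correlation_matrices. truncate T A = A}"
  have K: "?K = correlation_matrices \<inter> {A. truncate T A = A}"
    by blast
  have "linear (truncate T)"
    by (rule linearI) (auto simp: truncate_def vec_eq_iff)
  then have "subspace {A. truncate T A = A}"
    by (simp add: subspace_def linear_0 linear_add linear_cmul)
  then have cK: "compact ?K" "convex ?K"
    unfolding K
    by (simp_all add: compact_Int_closed compact_correlation_matrices closed_subspace convex_Int
        convex_correlation_matrices subspace_imp_convex)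
  have "{A. A extreme_point_of ?K} \<subseteq> unimodular_hull"
  proof (intro subsetI, unfold mem_Collect_eq)
    fix B assume B: "B extreme_point_of ?K"
    then have Bc: "B \<in> correlation_matrices" and Bt: "truncate T B = B"
      by (auto simp: extreme_point_of_def)
    have uni: "cmod (B $ m $ l) = 1" if ml: "m \<in> T" "l \<in> T" for m l
    proof (cases "m = l")
      case False
      have "card (T - {m, l}) = 1"
        using T ml False by (subst card_Diff_subset) auto
      then obtain k where "T - {m, l} = {k}"
        by (auto simp: card_1_singleton_iff)
      with ml have "T = {m, l, k}"
        by blast
      with extreme_triple_unimodular[of B m l k] B show ?thesis
        by simp
    qed (use Bc in \<open>simp add: correlation_matrices_iff\<close>)
    obtain i where i: "i \<in> T"
      using T by fastforce
    \<comment> \<open>On \<open>T\<close> the rank one factor is column \<open>i\<close> of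
      \<open>B\<close>; outside \<open>T\<close> the value 1 is an arbitrary unimodular choice,
      erased by truncation.\<close>
    define v where "v = (\<chi> m. if m \<in> T then B $ m $ i else 1)"
    have "cmod (v $ m) = 1" for m
      using uni i by (simp add: v_def)
    moreover have "B = truncate T (outer v)"
    proof -
      have "B $ m $ l = truncate T (outer v) $ m $ l" for m l
      proof -
        consider "m = l" | "m \<in> T" "l \<in> T" | "m \<noteq> l" "m \<notin> T \<or> l \<notin> T"
          by blast
        then show ?thesis
        proof cases
          case 1
          have "v $ l * cnj (v $ l) = 1"
            using \<open>cmod (v $ l) = 1\<close> by (simp add: complex_norm_square[symmetric])
          with 1 Bc show ?thesis
            by (simp add: truncate_nth outer_def correlation_matrices_iff)
        next
          case 2
          have "B $ m $ l = B $ m $ i * B $ i $ l"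
            using correlation_unimodular_entry[OF Bc] uni[OF i] 2 by blast
          with 2 Bc show ?thesis
            by (simp add: truncate_nth outer_def v_def correlation_matrices_iff hermitianD)
        next
          case 3
          then have "truncate T B $ m $ l = 0"
            by (auto simp: truncate_nth)
          with 3 Bt show ?thesis
            by (auto simp: truncate_nth)
        qed
      qed
      then show ?thesis
        by (simp add: vec_eq_iff)
    qed
    ultimately show "B \<in> unimodular_hull"
      by (simp add: truncate_unimodular_hull outer_unimodular_hull)
  qed
  then have "convex hull {A. A extreme_point_of ?K} \<subseteq> unimodular_hull"
    by (rule hull_minimal) (rule convex_unimodular_hull)
  then show ?thesis
    using Krein_Milman_Minkowski[OF cK] A tr by blast
qed

section \<open>Counting triples and averaging over them\<close>

lemma card_triples_containing:
  fixes i j :: "'n :: finite"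
  assumes "i \<noteq> j"
  shows "card {T. card T = 3 \<and> i \<in> T \<and> j \<in> T} = CARD('n) - 2"
proof -
  \<comment> \<open>Such a triple is determined by its third element.\<close>
  have "{T. card T = 3 \<and> i \<in> T \<and> j \<in> T} = (\<lambda>k. {i, j, k}) ` (UNIV - {i, j})"
  proof (intro equalityI subsetI)
    fix T assume "T \<in> {T. card T = 3 \<and> i \<in> T \<and> j \<in> T}"
    then have T: "card T = 3" "i \<in> T" "j \<in> T"
      by auto
    have "card (T - {i, j}) = 1"
      using T assms by (subst card_Diff_subset) auto
    then obtain k where k: "T - {i, j} = {k}"
      by (auto simp: card_1_singleton_iff)
    with T have "T = {i, j, k}" "k \<in> UNIV - {i, j}"
      by auto
    then show "T \<in> (\<lambda>k. {i, j, k}) ` (UNIV - {i, j})"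
      by blast
  qed (use assms in auto)
  moreover have "inj_on (\<lambda>k. {i, j, k}) (UNIV - {i, j})"
    by (rule inj_onI) auto
  ultimately have "card {T. card T = 3 \<and> i \<in> T \<and> j \<in> T} = card (UNIV - {i, j})"
    by (simp add: card_image)
  then show ?thesis
    using assms by (simp add: card_Diff_subset)
qed

lemma choose_3: "6 * real (n choose 3) = real n * (real n - 1) * (real n - 2)"
  by (simp add: binomial_gbinomial gbinomial_prod_rev numeral_3_eq_3 lessThan_Suc fact_numeral)

lemma triples_average:
  fixes X :: "complex^'n^'n"
  assumes n: "CARD('n) \<ge> 3" and X: "X \<in> correlation_matrices"
  defines "t \<equiv> 6 / ((real CARD('n))\<^sup>2 - real CARD('n))"
  shows "t *\<^sub>R X + (1 - t) *\<^sub>R mat 1 \<in> unimodular_hull"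
proof -
  let ?N = "real CARD('n)"
  let ?S = "{T :: 'n set. card T = 3}"
  define q where "q = 1 / real (card ?S)"
  have cS: "card ?S = CARD('n) choose 3"
    using n_subsets[of "UNIV :: 'n set" 3] by simp
  have cS0: "0 < real (card ?S)"
    using n by (simp add: cS zero_less_binomial_iff)
  have trunc: "truncate T X \<in> unimodular_hull" if "card T = 3" for T
  proof (rule triple_unimodular_hull[OF _ _ that])
    show "truncate T X \<in> correlation_matrices"
      by (rule truncate_correlation[OF X])
    show "truncate T (truncate T X) = truncate T X"
      by (simp add: vec_eq_iff truncate_nth)
  qed
  have "(\<Sum>T\<in>?S. q *\<^sub>R truncate T X) \<in> unimodular_hull"
  proof (rule convex_sum[OF _ convex_unimodular_hull])
    show "(\<Sum>T\<in>?S. q) = 1"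
      using n by (simp add: q_def cS)
    show "0 \<le> q"
      by (simp add: q_def)
  qed (simp_all add: trunc)
  moreover have "(\<Sum>T\<in>?S. q *\<^sub>R truncate T X) = t *\<^sub>R X + (1 - t) *\<^sub>R mat 1"
  proof -
    have "(\<Sum>T\<in>?S. q *\<^sub>R truncate T X) $ i $ j = (t *\<^sub>R X + (1 - t) *\<^sub>R mat 1) $ i $ j" for i j
    proof (cases "i = j")
      case True
      have "t *\<^sub>R (1 :: complex) + (1 - t) *\<^sub>R 1 = 1"
        by (simp flip: scaleR_left_distrib)
      moreover have "X $ j $ j = 1"
        using X by (simp add: correlation_matrices_iff)
      ultimately show ?thesis
        using n
        by (simp add: True truncate_nth mat_def q_def cS scaleR_conv_of_real[where 'a = complex])
    next
      case False
      have "(\<Sum>T\<in>?S. q *\<^sub>R truncate T X) $ i $ j =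
          (\<Sum>T\<in>?S. if i \<in> T \<and> j \<in> T then q *\<^sub>R X $ i $ j else 0)"
        using False by (simp add: truncate_nth if_distrib cong: if_cong)
      also have "\<dots> = (\<Sum>T\<in>{T. card T = 3 \<and> i \<in> T \<and> j \<in> T}. q *\<^sub>R X $ i $ j)"
        by (simp add: sum.If_cases Int_def conj_ac)
      also have "\<dots> = (real (CARD('n) - 2) * q) *\<^sub>R X $ i $ j"
        by (simp add: card_triples_containing[OF False] scaleR_conv_of_real[where 'a = complex])
      \<comment> \<open>The fraction of triples containing both \<open>i\<close> and
        \<open>j\<close>. From \<open>n\<close>, the natural subtraction is exact and the factor
        cancelled is nonzero.\<close>
      also have "real (CARD('n) - 2) * q = t"
      proof -
        have "real (card ?S) = ?N * (?N - 1) * (?N - 2) / 6"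
          using choose_3[of "CARD('n)"] by (simp add: cS)
        then have q: "q = 6 / ((?N - 2) * (?N * (?N - 1)))"
          by (simp only: q_def) simp
        have e: "real (CARD('n) - 2) = ?N - 2" and nz: "?N - 2 \<noteq> 0"
          using n by auto
        have "real (CARD('n) - 2) * q = 6 / (?N * (?N - 1))"
          by (simp only: e q times_divide_eq_right mult_divide_mult_cancel_left[OF nz])
        then show ?thesis
          by (simp add: t_def power2_eq_square right_diff_distrib)
      qed
      finally show ?thesis
        using False by (simp add: mat_def)
    qed
    then show ?thesis
      by (simp add: vec_eq_iff)
  qed
  ultimately show ?thesis
    by simp
qed

section \<open>The smallest eigenvalue\<close>

text \<open>The minimum \<open>m\<close> of the form on the unit sphere is attained at some
  \<open>v\<close>. Then \<open>X - m *\<^sub>R mat 1\<close> is semidefinite with form value 0 at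
  \<open>v\<close>, so Cauchy-Schwarz makes \<open>v\<close> an eigenvector for \<open>m\<close>,
  whence \<open>l \<le> m\<close>.\<close>

lemma pos_semidef_minus_smallest_eigenvalue:
  fixes X :: "complex^'n^'n"
  assumes h: "hermitian X" and l: "smallest_eigenvalue X l"
  shows "pos_semidef (X - l *\<^sub>R mat 1)"
proof -
  have cont: "continuous_on (sphere 0 1) (quad X)"
    unfolding quad_def by (intro continuous_intros)
  have "axis undefined 1 \<in> sphere (0 :: complex^'n) 1"
    by simp
  then obtain v where v: "v \<in> sphere 0 1" and min: "\<And>x. x \<in> sphere 0 1 \<Longrightarrow> quad X v \<le> quad X x"
    using continuous_attains_inf[OF compact_sphere _ cont] by blast
  define m where "m = quad X v"
  have quad_shift: "quad (X - r *\<^sub>R mat 1) x = quad X x - r * (norm x)\<^sup>2" for r x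
    using quad_add[of X "(- r) *\<^sub>R mat 1" x] by (simp only: quad_scaleR quad_mat_1) simp
  have herm_shift: "hermitian (X - r *\<^sub>R mat 1)" for r
    using hermitian_add_scaleR[OF h hermitian_mat_1, of 1 "- r"] by simp
  have ge: "m * (norm x)\<^sup>2 \<le> quad X x" for x
  proof (cases "x = 0")
    case False
    have "norm (of_real (1 / norm x) *s x) = 1"
    proof -
      have "of_real (1 / norm x) *s x = (1 / norm x) *\<^sub>R x"
        by (simp add: vec_eq_iff scaleR_conv_of_real[where 'a = complex])
      with False show ?thesis by simp
    qed
    then have "m \<le> quad X (of_real (1 / norm x) *s x)"
      using min by (simp add: m_def)
    with False show ?thesis
      unfolding quad_scale_vector by (simp add: field_simps)
  qed (simp add: quad_def)
  have psd: "pos_semidef (X - m *\<^sub>R mat 1)"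
    using ge by (simp add: pos_semidef_iff herm_shift quad_shift)
  have "X *v v = of_real m *s v"
  proof -
    have "quad (X - m *\<^sub>R mat 1) v = 0"
      using v by (simp add: quad_shift m_def)
    then have "((X - m *\<^sub>R mat 1) *v v) $ i = 0" for i
      using norm_mult_nth_le[OF psd, of v i] by simp
    then have "(X - m *\<^sub>R mat 1) *v v = 0"
      by (simp add: vec_eq_iff)
    moreover have "(m *\<^sub>R mat 1) *v v = of_real m *s v"
      by (simp add: vec_eq_iff matrix_vector_mult_def mat_def if_distrib if_distribR
          scaleR_conv_of_real[where 'a = complex] cong: if_cong)
    ultimately show ?thesis
      by (simp add: matrix_vector_mult_diff_rdistrib)
  qed
  moreover have "v \<noteq> 0"
    using v by auto
  ultimately have "l \<le> m"
    using l unfolding smallest_eigenvalue_def matrix_eigenvalue_def by blast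
  then have "l * (norm x)\<^sup>2 \<le> quad X x" for x
    using ge[of x] mult_right_mono[of l m "(norm x)\<^sup>2"] by simp
  then show ?thesis
    by (simp add: pos_semidef_iff herm_shift quad_shift)
qed

section \<open>Lower bounds for the coefficient\<close>

lemma corr_coeff_ge:
  assumes "0 \<le> t" "t \<le> 1" "t *\<^sub>R X + (1 - t) *\<^sub>R mat 1 \<in> unimodular_hull"
  shows "t \<le> corr_coeff X"
  unfolding corr_coeff_def
proof (rule cSup_upper)
  show "t \<in> {t \<in> {0..1}. t *\<^sub>R X + (1 - t) *\<^sub>R mat 1 \<in> rank_one_hull}"
    using assms unimodular_hull_subset by auto
  show "bdd_above {t \<in> {0..1}. t *\<^sub>R X + (1 - t) *\<^sub>R mat 1 \<in> rank_one_hull}"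
    by (rule bdd_aboveI[of _ 1]) simp
qed

theorem proposition4p1:
  fixes X :: "complex^'n^'n"
  assumes "CARD('n) \<ge> 3"
    and "X \<in> correlation_matrices"
  shows "corr_coeff X \<ge> 6 / ((real CARD('n))\<^sup>2 - real CARD('n)) \<and>
    (\<forall>l0. smallest_eigenvalue X l0 \<longrightarrow>
      corr_coeff X \<ge>
        (if l0 = 1 then 1
         else min (6 / (((real CARD('n))\<^sup>2 - real CARD('n)) * (1 - l0))) 1))"
proof (intro conjI allI impI)
  let ?N = "real CARD('n)"
  define t where "t = 6 / (?N\<^sup>2 - ?N)"
  have "3 * 2 \<le> ?N * (?N - 1)"
    using assms(1) by (intro mult_mono) auto
  then have D: "6 \<le> ?N\<^sup>2 - ?N"
    by (simp add: power2_eq_square algebra_simps)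
  then have D0: "0 < ?N\<^sup>2 - ?N"
    by linarith
  have t: "0 < t" "t \<le> 1"
    unfolding t_def divide_le_eq_1_pos[OF D0] using D by (simp_all only: divide_pos_pos[OF _ D0])
  show "6 / (?N\<^sup>2 - ?N) \<le> corr_coeff X"
    using t triples_average[OF assms] unfolding t_def by (intro corr_coeff_ge) auto
  fix l0 assume "smallest_eigenvalue X l0"
  let ?Y = "X - l0 *\<^sub>R mat 1"
  have X: "hermitian X" "\<And>i. X $ i $ i = 1"
    using assms(2) by (auto simp: correlation_matrices_iff)
  have psd: "pos_semidef ?Y"
    by (rule pos_semidef_minus_smallest_eigenvalue) fact+
  have diag: "?Y $ i $ i = of_real (1 - l0)" for i
    by (simp add: X mat_def scaleR_conv_of_real[where 'a = complex])
  have "l0 \<le> 1"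
  proof -
    have "0 \<le> quad ?Y (axis undefined 1)"
      using psd by (simp only: pos_semidef_iff)
    then show ?thesis
      unfolding quad_axis_1 diag by simp
  qed
  show "(if l0 = 1 then 1 else min (6 / ((?N\<^sup>2 - ?N) * (1 - l0))) 1) \<le> corr_coeff X"
  proof (cases "l0 = 1")
    case True
    \<comment> \<open>A semidefinite matrix with zero diagonal is zero.\<close>
    have "?Y $ i $ j = 0" for i j
      using norm_entry_le[OF psd, of i j] unfolding diag by (simp add: True)
    then have "X = mat 1"
      by (simp add: vec_eq_iff True)
    then have "1 \<le> corr_coeff X"
      by (intro corr_coeff_ge) (simp_all add: mat_1_unimodular_hull)
    with True show ?thesis
      by simp
  next
    case False
    with \<open>l0 \<le> 1\<close> have l0: "0 < 1 - l0"
      by simp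
    \<comment> \<open>Subtracting \<open>l0\<close> times the identity leaves \<open>1 - l0\<close>
      on the diagonal; rescaling gives a correlation matrix again.\<close>
    define Z where "Z = (1 / (1 - l0)) *\<^sub>R ?Y"
    define s where "s = t / (1 - l0)"
    \<comment> \<open>\<open>s\<close> may exceed 1, whereas the supremum ranges over parameters in
      the unit interval.\<close>
    define r where "r = min s 1"
    have s0: "0 < s"
      using t l0 by (simp add: s_def)
    have "Z \<in> correlation_matrices"
    proof -
      have "hermitian Z"
        using psd hermitian_add_scaleR[of ?Y ?Y "1 / (1 - l0)" 0]
        by (simp add: pos_semidef_iff Z_def)
      moreover have "0 \<le> quad Z x" for x
        using psd l0 by (simp add: pos_semidef_iff Z_def quad_scaleR)
      moreover have "Z $ i $ i = 1" for i
        unfolding Z_def vector_scaleR_component diag using l0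
        by (simp add: scaleR_conv_of_real[where 'a = complex] flip: of_real_mult)
      ultimately show ?thesis
        by (simp add: correlation_matrices_iff)
    qed
    then have Z: "t *\<^sub>R Z + (1 - t) *\<^sub>R mat 1 \<in> unimodular_hull"
      using triples_average[OF assms(1)] by (simp add: t_def)
    have sX: "t *\<^sub>R Z + (1 - t) *\<^sub>R mat 1 = s *\<^sub>R X + (1 - s) *\<^sub>R mat 1"
    proof -
      have "t *\<^sub>R Z + (1 - t) *\<^sub>R mat 1 = s *\<^sub>R X + (1 - t - s * l0) *\<^sub>R mat 1"
        by (simp add: Z_def s_def scaleR_right_diff_distrib scaleR_left_diff_distrib)
      also have "t + s * l0 = s"
        using l0 by (simp add: s_def field_simps)
      then have "1 - t - s * l0 = 1 - s"
        by simp
      finally show ?thesis .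
    qed
    have "r *\<^sub>R X + (1 - r) *\<^sub>R mat 1 \<in> unimodular_hull"
    proof -
      \<comment> \<open>Mixing with the identity at weight \<open>r / s\<close>, which is at most 1,
        lowers the parameter from \<open>s\<close> to \<open>r\<close>.\<close>
      have "(r / s) *\<^sub>R (s *\<^sub>R X + (1 - s) *\<^sub>R mat 1) + (1 - r / s) *\<^sub>R mat 1 \<in> unimodular_hull"
      proof (rule convexD[OF convex_unimodular_hull _ mat_1_unimodular_hull])
        show "s *\<^sub>R X + (1 - s) *\<^sub>R mat 1 \<in> unimodular_hull"
          using Z by (simp only: sX)
      qed (use s0 in \<open>auto simp: r_def min_def\<close>)
      moreover have "(r / s) *\<^sub>R (s *\<^sub>R X + (1 - s) *\<^sub>R mat 1) + (1 - r / s) *\<^sub>R mat 1 =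
          r *\<^sub>R X + ((r / s) * (1 - s) + (1 - r / s)) *\<^sub>R mat 1"
        using s0 by (simp add: scaleR_right_distrib scaleR_left_distrib)
      moreover have "(r / s) * (1 - s) + (1 - r / s) = 1 - r"
        using s0 by (simp add: field_simps)
      ultimately show ?thesis
        by (simp only:)
    qed
    then have "r \<le> corr_coeff X"
      using s0 by (intro corr_coeff_ge) (auto simp: r_def)
    with False show ?thesis
      by (simp add: r_def s_def t_def)
  qed
qed

end
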